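(* Let $1 < q \le 2$. Let $\{t_n\}_{n=1}^\infty$ be a weakness sequence with $\liminf_{n\to\infty} t_n > 0$, $\{\delta_n\}_{n=0}^\infty$ a perturbation sequence, and $\{\eta_n\}_{n=1}^\infty$ a bounded error sequence. Then the AWCGA with these sequences converges for every Banach space $X \in \mathcal{P}_q$, every dictionary $\mathcal{D}$ in $X$, and every element $f \in X$ if and only if $$\liminf_{n\to\infty}\,(\delta_n+\eta_n)=0.$$
   Context: Banach spaces are real. The modulus of smoothness of $X$ is $\rho(u) = \sup_{\|x\|=\|y\|=1} \frac{\|x+uy\|+\|x-uy\|}{2} - 1$. For $1<q\le 2$, $\mathcal{P}_q$ is the class of all Banach spaces whose modulus of smoothness satisfies $\rho(u) \le \gamma u^q$ (for all $u \geq 0$) for some $\gamma>0$. A dictionary in $X$ is a set $\mathcal{D}\subset X$ with $\|g\|=1$ for all $g\in\mathcal{D}$ and $\overline{\mathrm{span}}\,\mathcal{D}=X$; dictionaries are assumed symmetric ($g\in\mathcal{D}$ implies $-g\in\mathcal{D}$). A weakness sequence $\{t_n\}_{n\ge1}$ has $0\le t_n\le1$; a perturbation sequence $\{\delta_n\}_{n\ge0}$ has $0\le\delta_n\le1$; an error sequence $\{\eta_n\}_{n\ge1}$ has $\eta_n\ge0$. Approximate Weak Chebyshev Greedy Algorithm (AWCGA) of $f\in X$ with these sequences: set $f_0=f$, and for $n\ge1$: (1) take any bounded linear functional $F_{n-1}$ on $X$ with $\|F_{n-1}\|\le1$ and $F_{n-1}(f_{n-1})\ge(1-\delta_{n-1})\|f_{n-1}\|$,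 and any $\phi_n\in\mathcal{D}$ with $F_{n-1}(\phi_n)\ge t_n\sup_{g\in\mathcal{D}}F_{n-1}(g)$; (2) let $\Phi_n=\mathrm{span}\{\phi_1,\dots,\phi_n\}$, $E_n=\inf_{G\in\Phi_n}\|f-G\|$, and take any $G_n\in\Phi_n$ with $\|f-G_n\|\le(1+\eta_n)E_n$; (3) set $f_n=f-G_n$. Any sequence of admissible choices is a realization. The AWCGA of $f$ converges if $\|f_n\|\to0$ for every realization; it diverges (does not converge) if there is a realization with $\|f_n\|\not\to0$. *)

theory Defs
  imports "HOL-Analysis.Analysis"
begin

text \<open>
  HOL cannot quantify over types inside a formula, so a Banach space is given here by a linear
  subspace \<open>X\<close> of an ambient real vector space \<open>'a\<close> together with a complete norm \<open>N\<close> on \<open>X\<close>.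
  Only the vector space operations come from \<open>'a\<close>; there is no norm or topology on \<open>'a\<close>, and the
  values of \<open>N\<close> outside \<open>X\<close> are irrelevant.  As \<open>'a\<close> is an arbitrary type of class
  \<open>real_vector\<close>, every real Banach space is obtained (with \<open>X = UNIV\<close> if \<open>'a\<close> is the space itself,
  or as a factor of a larger \<open>'a\<close>).
\<close>

definition norm_on :: "'a::real_vector set \<Rightarrow> ('a \<Rightarrow> real) \<Rightarrow> bool" where
  "norm_on X N \<longleftrightarrow>
     subspace X \<and>
     (\<forall>x\<in>X. 0 \<le> N x) \<and>
     (\<forall>x\<in>X. N x = 0 \<longleftrightarrow> x = 0) \<and>
     (\<forall>c. \<forall>x\<in>X. N (c *\<^sub>R x) = \<bar>c\<bar> * N x) \<and>
     (\<forall>x\<in>X. \<forall>y\<in>X. N (x + y) \<le> N x + N y)"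

text \<open>The locale \<open>Metric_space\<close> asks for nonnegativity and symmetry on the whole type, hence the
  default value outside \<open>X\<close>.\<close>

definition norm_dist :: "'a::real_vector set \<Rightarrow> ('a \<Rightarrow> real) \<Rightarrow> 'a \<Rightarrow> 'a \<Rightarrow> real" where
  "norm_dist X N x y = (if x \<in> X \<and> y \<in> X then N (x - y) else 0)"

definition banach_space :: "'a::real_vector set \<Rightarrow> ('a \<Rightarrow> real) \<Rightarrow> bool" where
  "banach_space X N \<longleftrightarrow> norm_on X N \<and> Metric_space.mcomplete X (norm_dist X N)"

lemma Metric_space_norm_dist:
  assumes "norm_on X N"
  shows "Metric_space X (norm_dist X N)"
proof -
  have diff: "x - y \<in> X" if "x \<in> X" "y \<in> X" for x y
    using assms that by (simp add: norm_on_def subspace_diff)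
  have pos: "0 \<le> N x" if "x \<in> X" for x
    using assms that by (simp add: norm_on_def)
  have zero: "N x = 0 \<longleftrightarrow> x = 0" if "x \<in> X" for x
    using assms that by (simp add: norm_on_def)
  have scale: "N (c *\<^sub>R x) = \<bar>c\<bar> * N x" if "x \<in> X" for c x
    using assms that by (simp add: norm_on_def)
  have triangle: "N (x + y) \<le> N x + N y" if "x \<in> X" "y \<in> X" for x y
    using assms that by (simp add: norm_on_def)
  show ?thesis
  proof (rule Metric_space.intro)
    show "0 \<le> norm_dist X N x y" for x y
      by (simp add: norm_dist_def pos diff)
    show "norm_dist X N x y = norm_dist X N y x" for x y
      using scale[of "x - y" "-1"] diff[of x y] by (simp add: norm_dist_def)
    show "norm_dist X N x y = 0 \<longleftrightarrow> x = y" if "x \<in> X" "y \<in> X" for x y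
      using zero[of "x - y"] diff[of x y] that by (simp add: norm_dist_def)
    show "norm_dist X N x z \<le> norm_dist X N x y + norm_dist X N y z"
      if "x \<in> X" "y \<in> X" "z \<in> X" for x y z
      using triangle[of "x - y" "y - z"] diff[of x y] diff[of y z] that
      by (simp add: norm_dist_def)
  qed
qed

lemma banach_space_UNIV: "banach_space (UNIV :: 'a::banach set) norm"
proof -
  have "norm_dist (UNIV :: 'a set) norm = dist"
    by (intro ext) (simp add: norm_dist_def dist_norm)
  moreover have "Met_TC.mcomplete TYPE('a)"
    by (simp add: complete_UNIV)
  ultimately show ?thesis
    by (simp add: banach_space_def norm_on_def norm_triangle_ineq)
qed

definition modulus_of_smoothness :: "'a::real_vector set \<Rightarrow> ('a \<Rightarrow> real) \<Rightarrow> real \<Rightarrow> real" where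
  "modulus_of_smoothness X N u =
     (SUP (x, y) \<in> {(x, y). x \<in> X \<and> y \<in> X \<and> N x = 1 \<and> N y = 1}.
        (N (x + u *\<^sub>R y) + N (x - u *\<^sub>R y)) / 2 - 1)"

definition class_P :: "real \<Rightarrow> 'a::real_vector set \<Rightarrow> ('a \<Rightarrow> real) \<Rightarrow> bool" where
  "class_P q X N \<longleftrightarrow>
     banach_space X N \<and> (\<exists>\<gamma>>0. \<forall>u\<ge>0. modulus_of_smoothness X N u \<le> \<gamma> * u powr q)"

definition dictionary :: "'a::real_vector set \<Rightarrow> ('a \<Rightarrow> real) \<Rightarrow> 'a set \<Rightarrow> bool" where
  "dictionary X N D \<longleftrightarrow>
     D \<subseteq> X \<and>
     (\<forall>g\<in>D. N g = 1) \<and>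
     (\<forall>g\<in>D. - g \<in> D) \<and>
     Metric_space.mtopology X (norm_dist X N) closure_of (span D) = X"

definition bounded_functional :: "'a::real_vector set \<Rightarrow> ('a \<Rightarrow> real) \<Rightarrow> ('a \<Rightarrow> real) \<Rightarrow> bool" where
  "bounded_functional X N F \<longleftrightarrow>
     (\<forall>x\<in>X. \<forall>y\<in>X. F (x + y) = F x + F y) \<and>
     (\<forall>c. \<forall>x\<in>X. F (c *\<^sub>R x) = c * F x) \<and>
     (\<exists>K. \<forall>x\<in>X. \<bar>F x\<bar> \<le> K * N x)"

definition functional_norm :: "'a::real_vector set \<Rightarrow> ('a \<Rightarrow> real) \<Rightarrow> ('a \<Rightarrow> real) \<Rightarrow> real" where
  "functional_norm X N F = (SUP x \<in> {x \<in> X. N x \<le> 1}. \<bar>F x\<bar>)"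

definition weakness_sequence :: "(nat \<Rightarrow> real) \<Rightarrow> bool" where
  "weakness_sequence t \<longleftrightarrow> (\<forall>n\<ge>1. 0 \<le> t n \<and> t n \<le> 1)"

definition perturbation_sequence :: "(nat \<Rightarrow> real) \<Rightarrow> bool" where
  "perturbation_sequence \<delta> \<longleftrightarrow> (\<forall>n. 0 \<le> \<delta> n \<and> \<delta> n \<le> 1)"

definition error_sequence :: "(nat \<Rightarrow> real) \<Rightarrow> bool" where
  "error_sequence \<eta> \<longleftrightarrow> (\<forall>n\<ge>1. 0 \<le> \<eta> n)"

definition best_error :: "('a::real_vector \<Rightarrow> real) \<Rightarrow> 'a \<Rightarrow> 'a set \<Rightarrow> real" where
  "best_error N f \<Phi> = (INF G \<in> \<Phi>. N (f - G))"

text \<open>\<open>r n\<close> is the residual \<open>f\<^sub>n\<close>; the entries \<open>\<phi> 0\<close> and \<open>G 0\<close> (like \<open>t 0\<close> and \<open>\<eta> 0\<close>) are unused.\<close>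

definition AWCGA_realization ::
  "'a::real_vector set \<Rightarrow> ('a \<Rightarrow> real) \<Rightarrow> 'a set \<Rightarrow>
   (nat \<Rightarrow> real) \<Rightarrow> (nat \<Rightarrow> real) \<Rightarrow> (nat \<Rightarrow> real) \<Rightarrow> 'a \<Rightarrow>
   (nat \<Rightarrow> 'a \<Rightarrow> real) \<Rightarrow> (nat \<Rightarrow> 'a) \<Rightarrow> (nat \<Rightarrow> 'a) \<Rightarrow> (nat \<Rightarrow> 'a) \<Rightarrow> bool" where
  "AWCGA_realization X N D t \<delta> \<eta> f F \<phi> G r \<longleftrightarrow>
     r 0 = f \<and>
     (\<forall>n\<ge>1.
        bounded_functional X N (F (n - 1)) \<and>
        functional_norm X N (F (n - 1)) \<le> 1 \<and>
        F (n - 1) (r (n - 1)) \<ge> (1 - \<delta> (n - 1)) * N (r (n - 1)) \<and>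
        \<phi> n \<in> D \<and>
        F (n - 1) (\<phi> n) \<ge> t n * (SUP g\<in>D. F (n - 1) g) \<and>
        G n \<in> span (\<phi> ` {1..n}) \<and>
        N (f - G n) \<le> (1 + \<eta> n) * best_error N f (span (\<phi> ` {1..n})) \<and>
        r n = f - G n)"

definition AWCGA_converges ::
  "'a::real_vector set \<Rightarrow> ('a \<Rightarrow> real) \<Rightarrow> 'a set \<Rightarrow>
   (nat \<Rightarrow> real) \<Rightarrow> (nat \<Rightarrow> real) \<Rightarrow> (nat \<Rightarrow> real) \<Rightarrow> 'a \<Rightarrow> bool" where
  "AWCGA_converges X N D t \<delta> \<eta> f \<longleftrightarrow>
     (\<forall>F \<phi> G r. AWCGA_realization X N D t \<delta> \<eta> f F \<phi> G r \<longrightarrow> (\<lambda>n. N (r n)) \<longlonglongrightarrow> 0)"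

text \<open>
  Condition on the ambient type only: it has to be large enough to contain vector spaces of every
  finite dimension.  It does not exclude any Banach space, since every real vector space
  embeds into an infinite-dimensional one (e.g. as a factor of a product).
\<close>

definition infinite_dimensional :: "'a::real_vector itself \<Rightarrow> bool" where
  "infinite_dimensional _ \<longleftrightarrow> \<not> (\<exists>B :: 'a set. finite B \<and> span B = UNIV)"

end

theory Submission
  imports Defs
begin

text \<open>
  Sufficiency is decided at a single step.  Let \<open>\<alpha>\<close> be the limit of the
  decreasing best errors \<open>E\<^sub>n\<close>.  Since \<open>\<eta>\<close> is bounded, \<open>\<alpha> = 0\<close> gives convergence.  Suppose
  \<open>\<alpha> > 0\<close> and take a late \<open>n\<close> with \<open>\<delta>\<^sub>n + \<eta>\<^sub>n\<close> tiny.  Smoothness turns an almost norming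
  functional \<open>F\<^sub>n\<close> into an almost exact derivative of the norm at \<open>f\<^sub>n\<close>
  (\<open>near_norming_step\<close>).  Used along \<open>- G\<^sub>n\<close>, where near-optimality of \<open>f\<^sub>n\<close> excludes any
  real decrease of the norm, it shows that \<open>F\<^sub>n(G\<^sub>n)\<close> cannot be very negative, so
  \<open>F\<^sub>n(f) \<ge> \<alpha> / 2\<close>.  Approximating \<open>f\<close> once and for all by a finite combination of dictionary
  elements bounds \<open>sup\<^sub>D F\<^sub>n\<close> from below uniformly in \<open>n\<close>, and hence \<open>F\<^sub>n(\<phi>\<^sub>n\<^sub>+\<^sub>1)\<close> as well.  Used
  along \<open>\<phi>\<^sub>n\<^sub>+\<^sub>1\<close> the same inequality yields a decrease of the error by a fixed amount, so
  \<open>E\<^sub>n\<^sub>+\<^sub>1 < \<alpha>\<close>, a contradiction (\<open>AWCGA_converges_if_uniformly_smooth\<close>).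

  For necessity, suppose that from some \<open>m\<close> on always \<open>\<delta>\<^sub>k \<ge> \<kappa>\<close> or \<open>\<eta>\<^sub>k \<ge> \<kappa>\<close>.  In Euclidean
  \<open>n\<close>-space with dictionary \<open>\<plusminus>b\<^sub>i\<close> and \<open>f = b\<^sub>0 + \<dots> + b\<^sub>n\<^sub>-\<^sub>1\<close> the exact algorithm may remove
  \<open>b\<^sub>0, b\<^sub>1, \<dots>, b\<^sub>m\<^sub>-\<^sub>1\<close> in turn.  After that the algorithm can choose \<open>b\<^sub>m\<^sub>-\<^sub>1\<close> again and again:
  at each step the functional is the normalized inner product with \<open>b\<^sub>m\<^sub>-\<^sub>1 + \<dots> + b\<^sub>n\<^sub>-\<^sub>1\<close>, which is
  maximal at \<open>b\<^sub>m\<^sub>-\<^sub>1\<close>.  This is allowed, because for large \<open>n\<close> the presence of one coordinate hardly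
  changes norms: if \<open>\<eta>\<^sub>k\<close> is large then \<open>b\<^sub>m\<^sub>-\<^sub>1\<close> may be left in the residual, and if \<open>\<delta>\<^sub>k\<close> is large
  then the functional may see \<open>b\<^sub>m\<^sub>-\<^sub>1\<close> although the residual does not contain it
  (\<open>AWCGA_stalls\<close>).  Only finite dimensions occur, so any infinite-dimensional ambient space
  accommodates the example.
\<close>

section \<open>Lower limits\<close>

lemma liminf_pos_iff:
  fixes u :: "nat \<Rightarrow> real"
  shows "0 < liminf (\<lambda>n. ereal (u n)) \<longleftrightarrow> (\<exists>c>0. \<forall>\<^sub>F n in sequentially. c \<le> u n)"
proof
  assume "0 < liminf (\<lambda>n. ereal (u n))"
  then obtain c where c: "0 < ereal c" "ereal c < liminf (\<lambda>n. ereal (u n))"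
    using ereal_dense2 by blast
  have "\<forall>\<^sub>F n in sequentially. ereal c < ereal (u n)"
    using less_LiminfD[OF c(2)] .
  then have "\<forall>\<^sub>F n in sequentially. c \<le> u n"
    by eventually_elim simp
  with c(1) show "\<exists>c>0. \<forall>\<^sub>F n in sequentially. c \<le> u n"
    by auto
next
  assume "\<exists>c>0. \<forall>\<^sub>F n in sequentially. c \<le> u n"
  then obtain c where c: "c > 0" "\<forall>\<^sub>F n in sequentially. c \<le> u n"
    by blast
  have "ereal c \<le> liminf (\<lambda>n. ereal (u n))"
    by (rule Liminf_bounded) (use c(2) in simp)
  moreover have "0 < ereal c"
    using c(1) by simp
  ultimately show "0 < liminf (\<lambda>n. ereal (u n))"
    by (rule less_le_trans[rotated])
qed

lemma liminf_eq_0_iff: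
  fixes u :: "nat \<Rightarrow> real"
  assumes "\<forall>\<^sub>F n in sequentially. 0 \<le> u n"
  shows "liminf (\<lambda>n. ereal (u n)) = 0 \<longleftrightarrow> (\<forall>c>0. \<exists>\<^sub>F n in sequentially. u n < c)"
proof -
  have "0 \<le> liminf (\<lambda>n. ereal (u n))"
    by (rule Liminf_bounded) (use assms in simp)
  then have "liminf (\<lambda>n. ereal (u n)) = 0 \<longleftrightarrow> \<not> 0 < liminf (\<lambda>n. ereal (u n))"
    by auto
  then show ?thesis
    unfolding liminf_pos_iff frequently_def not_less by metis
qed

section \<open>Norms and functionals\<close>

lemma
  assumes "norm_on X N"
  shows norm_on_subspace: "subspace X"
    and norm_on_nonneg: "x \<in> X \<Longrightarrow> 0 \<le> N x"
    and norm_on_eq_0_iff: "x \<in> X \<Longrightarrow> N x = 0 \<longleftrightarrow> x = 0"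
    and norm_on_scale: "x \<in> X \<Longrightarrow> N (c *\<^sub>R x) = \<bar>c\<bar> * N x"
    and norm_on_triangle: "x \<in> X \<Longrightarrow> y \<in> X \<Longrightarrow> N (x + y) \<le> N x + N y"
  using assms by (auto simp: norm_on_def)

lemma norm_on_minus:
  assumes "norm_on X N" "x \<in> X"
  shows "N (- x) = N x"
  using norm_on_scale[OF assms, of "-1"] by simp

lemma norm_on_triangle_diff:
  assumes "norm_on X N" "x \<in> X" "y \<in> X"
  shows "N (x - y) \<le> N x + N y"
  using norm_on_triangle[OF assms(1,2), of "- y"] assms
  by (simp add: norm_on_minus subspace_neg norm_on_subspace)

lemma
  assumes "bounded_functional X N F"
  shows bounded_functional_add: "x \<in> X \<Longrightarrow> y \<in> X \<Longrightarrow> F (x + y) = F x + F y"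
    and bounded_functional_scale: "x \<in> X \<Longrightarrow> F (c *\<^sub>R x) = c * F x"
  using assms by (simp_all add: bounded_functional_def)

lemma bounded_functional_abs_le:
  assumes N: "norm_on X N" and F: "bounded_functional X N F" "functional_norm X N F \<le> 1"
    and x: "x \<in> X"
  shows "\<bar>F x\<bar> \<le> N x"
proof (cases "x = 0")
  case True
  have "F (0 *\<^sub>R x) = 0 * F x"
    by (rule bounded_functional_scale[OF F(1) x])
  then show ?thesis
    using True norm_on_nonneg[OF N x] by simp
next
  case False
  then have pos: "N x > 0"
    using norm_on_nonneg[OF N x] norm_on_eq_0_iff[OF N x] by simp
  define y where "y = (1 / N x) *\<^sub>R x"
  have y: "y \<in> X" "N y \<le> 1"
    using pos x norm_on_scale[OF N x, of "1 / N x"] norm_on_subspace[OF N]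
    by (auto simp: y_def subspace_scale)
  obtain K where K: "\<And>x. x \<in> X \<Longrightarrow> \<bar>F x\<bar> \<le> K * N x"
    using F(1) unfolding bounded_functional_def by blast
  have "bdd_above ((\<lambda>x. \<bar>F x\<bar>) ` {x \<in> X. N x \<le> 1})"
  proof (rule bdd_aboveI2)
    fix z assume z: "z \<in> {x \<in> X. N x \<le> 1}"
    have "\<bar>F z\<bar> \<le> K * N z"
      using K z by simp
    also have "\<dots> \<le> \<bar>K\<bar> * 1"
      using z norm_on_nonneg[OF N, of z] by (intro mult_mono) auto
    finally show "\<bar>F z\<bar> \<le> \<bar>K\<bar>" by simp
  qed
  then have "\<bar>F y\<bar> \<le> functional_norm X N F"
    unfolding functional_norm_def using y by (intro cSUP_upper) auto
  then have "\<bar>F y\<bar> \<le> 1"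
    using F(2) by simp
  moreover have "F y = F x / N x"
    using bounded_functional_scale[OF F(1) x, of "1 / N x"] by (simp add: y_def)
  ultimately show ?thesis
    using pos by (simp add: field_simps)
qed

text \<open>A combination \<open>\<Sum> c\<^sub>j g\<^sub>j\<close> of dictionary elements has
  \<open>\<bar>F x\<bar> \<le> (\<Sum> \<bar>c\<^sub>j\<bar>) sup\<^sub>D F\<close>, because \<open>D\<close> is symmetric.  The point is that the
  constant depends on the combination and not on \<open>F\<close>.\<close>

lemma span_dictionary_functional_bound:
  assumes N: "norm_on X N" and D: "dictionary X N D" and x: "x \<in> span D"
  shows "\<exists>A\<ge>0. \<forall>F. bounded_functional X N F \<longrightarrow> functional_norm X N F \<le> 1 \<longrightarrow>
           \<bar>F x\<bar> \<le> A * (SUP g\<in>D. F g)"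
proof -
  let ?bound = "\<lambda>A x. \<forall>F. bounded_functional X N F \<longrightarrow> functional_norm X N F \<le> 1 \<longrightarrow>
           \<bar>F x\<bar> \<le> A * (SUP g\<in>D. F g)"
  have "x \<in> X \<and> (\<exists>A\<ge>0. ?bound A x)"
    using x
  proof (induction rule: span_induct_alt)
    case base
    have "\<bar>F 0\<bar> \<le> 0" if "bounded_functional X N F" "functional_norm X N F \<le> 1" for F
      using bounded_functional_abs_le[OF N that subspace_0[OF norm_on_subspace[OF N]]]
        norm_on_eq_0_iff[OF N subspace_0[OF norm_on_subspace[OF N]]] by simp
    then show ?case
      using subspace_0[OF norm_on_subspace[OF N]] by (intro conjI exI[of _ 0]) auto
  next
    case (step c g y)
    then obtain A where A: "A \<ge> 0"
      "\<And>F. bounded_functional X N F \<Longrightarrow> functional_norm X N F \<le> 1 \<Longrightarrow> \<bar>F y\<bar> \<le> A * (SUP g\<in>D. F g)"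
      by blast
    have sub: "subspace X" "D \<subseteq> X"
      using norm_on_subspace[OF N] D by (auto simp: dictionary_def)
    have yX: "y \<in> X"
      using step by blast
    have gX: "g \<in> X" "- g \<in> D"
      using step(1) sub D by (auto simp: dictionary_def)
    have "\<bar>F (c *\<^sub>R g + y)\<bar> \<le> (\<bar>c\<bar> + A) * (SUP g\<in>D. F g)"
      if F: "bounded_functional X N F" "functional_norm X N F \<le> 1" for F
    proof -
      have bdd: "bdd_above (F ` D)"
      proof (rule bdd_aboveI2)
        fix h assume "h \<in> D"
        then show "F h \<le> 1"
          using bounded_functional_abs_le[OF N F, of h] D sub(2) by (auto simp: dictionary_def)
      qed
      have "F ((-1) *\<^sub>R g) = (-1) * F g"
        by (rule bounded_functional_scale[OF F(1) gX(1)])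
      then have "\<bar>F g\<bar> \<le> (SUP g\<in>D. F g)"
        using cSUP_upper[OF step(1) bdd] cSUP_upper[OF gX(2) bdd] by simp
      then have "\<bar>c\<bar> * \<bar>F g\<bar> \<le> \<bar>c\<bar> * (SUP g\<in>D. F g)"
        by (intro mult_left_mono) auto
      moreover have "F (c *\<^sub>R g + y) = c * F g + F y"
        using bounded_functional_add[OF F(1) _ yX] bounded_functional_scale[OF F(1) gX(1)]
          subspace_scale[OF sub(1) gX(1)] by simp
      ultimately show ?thesis
        using A(2)[OF F] abs_triangle_ineq[of "c * F g" "F y"]
        by (simp add: abs_mult algebra_simps)
    qed
    moreover have "c *\<^sub>R g + y \<in> X"
      using gX(1) yX sub(1) by (simp add: subspace_add subspace_scale)
    ultimately show ?case
      using A(1) by (intro conjI exI[of _ "\<bar>c\<bar> + A"]) auto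
  qed
  then show ?thesis
    by blast
qed

lemma dictionary_approximates:
  assumes N: "norm_on X N" and D: "dictionary X N D" and f: "f \<in> X" and "\<epsilon> > 0"
  shows "\<exists>g\<in>span D. N (f - g) < \<epsilon>"
proof -
  interpret Metric_space X "norm_dist X N"
    by (rule Metric_space_norm_dist[OF N])
  have "f \<in> mtopology closure_of (span D)"
    using D f by (simp add: dictionary_def)
  then obtain g where "g \<in> span D" "g \<in> mball f \<epsilon>"
    using \<open>\<epsilon> > 0\<close> unfolding metric_closure_of by blast
  then show ?thesis
    by (auto simp: in_mball norm_dist_def)
qed

section \<open>Uniform smoothness\<close>

text \<open>The supremum is over a set bounded by \<open>\<bar>u\<bar>\<close>, so it is a true upper bound.\<close>

lemma modulus_of_smoothness_upper:
  assumes N: "norm_on X N" and x: "x \<in> X" "N x = 1" and y: "y \<in> X" "N y = 1"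
  shows "(N (x + u *\<^sub>R y) + N (x - u *\<^sub>R y)) / 2 - 1 \<le> modulus_of_smoothness X N u"
proof -
  let ?S = "{(x, y). x \<in> X \<and> y \<in> X \<and> N x = 1 \<and> N y = 1}"
  let ?h = "\<lambda>(x, y). (N (x + u *\<^sub>R y) + N (x - u *\<^sub>R y)) / 2 - 1"
  have "?h p \<le> \<bar>u\<bar>" if "p \<in> ?S" for p
  proof -
    obtain a b where p: "p = (a, b)" "a \<in> X" "b \<in> X" "N a = 1" "N b = 1"
      using \<open>p \<in> ?S\<close> by auto
    have ub: "u *\<^sub>R b \<in> X" "N (u *\<^sub>R b) = \<bar>u\<bar>"
      using p norm_on_scale[OF N p(3)] norm_on_subspace[OF N] by (auto simp: subspace_scale)
    show ?thesis
      using norm_on_triangle[OF N p(2) ub(1)] norm_on_triangle_diff[OF N p(2) ub(1)] p ub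
      by (simp add: field_simps)
  qed
  then have "bdd_above (?h ` ?S)"
    by (rule bdd_aboveI2)
  then have "?h (x, y) \<le> (SUP p\<in>?S. ?h p)"
    using x y by (intro cSUP_upper) auto
  then show ?thesis
    by (simp add: modulus_of_smoothness_def)
qed

text \<open>All that the algorithm needs from \<open>\<rho>(u) \<le> \<gamma> u\<^bsup>q\<^esup>\<close> with \<open>q > 1\<close> is \<open>\<rho>(u) = o(u)\<close>.  The
  following form normalizes neither vector: \<open>x\<close> stays
  away from \<open>0\<close>, and the error is linear in \<open>N y\<close> with a small slope.\<close>

definition uniformly_smooth :: "'a::real_vector set \<Rightarrow> ('a \<Rightarrow> real) \<Rightarrow> bool" where
  "uniformly_smooth X N \<longleftrightarrow>
     (\<forall>\<alpha>>0. \<forall>\<epsilon>>0. \<exists>\<mu>>0. \<forall>x\<in>X. \<forall>y\<in>X. \<alpha> \<le> N x \<longrightarrow> N y \<le> \<mu> \<longrightarrow>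
        N (x + y) + N (x - y) \<le> 2 * N x + \<epsilon> * N y)"

lemma class_P_imp_uniformly_smooth:
  assumes q: "1 < q" and P: "class_P q X N"
  shows "uniformly_smooth X N"
  unfolding uniformly_smooth_def
proof (intro allI impI)
  fix \<alpha> \<epsilon> :: real assume pos: "\<alpha> > 0" "\<epsilon> > 0"
  have N: "norm_on X N"
    using P by (simp add: class_P_def banach_space_def)
  obtain \<gamma> where \<gamma>: "\<gamma> > 0" "\<And>u. u \<ge> 0 \<Longrightarrow> modulus_of_smoothness X N u \<le> \<gamma> * u powr q"
    using P by (auto simp: class_P_def)
  \<comment> \<open>With this radius every \<open>u \<le> \<mu> / \<alpha>\<close> satisfies \<open>2 \<gamma> u\<^bsup>q - 1\<^esup> \<le> \<epsilon>\<close>.\<close>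
  define \<mu> where "\<mu> = \<alpha> * (\<epsilon> / (2 * \<gamma>)) powr (1 / (q - 1))"
  have "\<mu> > 0"
    using pos \<gamma>(1) by (simp add: \<mu>_def)
  moreover have "N (x + y) + N (x - y) \<le> 2 * N x + \<epsilon> * N y"
    if x: "x \<in> X" "\<alpha> \<le> N x" and y: "y \<in> X" "N y \<le> \<mu>" for x y
  proof (cases "y = 0")
    case True
    then show ?thesis
      using norm_on_eq_0_iff[OF N y(1)] by simp
  next
    case False
    then have Ny: "N y > 0"
      using norm_on_nonneg[OF N y(1)] norm_on_eq_0_iff[OF N y(1)] by simp
    have Nx: "N x > 0"
      using x pos by simp
    define u where "u = N y / N x"
    have u: "u > 0"
      using Nx Ny by (simp add: u_def)
    have "u \<le> \<mu> / \<alpha>"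
      unfolding u_def using x y pos Ny by (intro frac_le) auto
    then have "u powr (q - 1) \<le> (\<mu> / \<alpha>) powr (q - 1)"
      using q u by (intro powr_mono2) auto
    also have "\<dots> = \<epsilon> / (2 * \<gamma>)"
      using q pos \<gamma>(1) by (simp add: \<mu>_def powr_powr)
    finally have small: "2 * \<gamma> * u powr (q - 1) \<le> \<epsilon>"
      using \<gamma>(1) by (simp add: field_simps)
    define x' y' where "x' = (1 / N x) *\<^sub>R x" and "y' = (1 / N y) *\<^sub>R y"
    have x': "x' \<in> X" "N x' = 1" and y': "y' \<in> X" "N y' = 1"
      using x y Nx Ny norm_on_scale[OF N] norm_on_subspace[OF N]
      by (auto simp: x'_def y'_def subspace_scale)
    have "(N (x' + u *\<^sub>R y') + N (x' - u *\<^sub>R y')) / 2 - 1 \<le> \<gamma> * u powr q"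
      using modulus_of_smoothness_upper[OF N x' y', of u] \<gamma>(2)[of u] u by simp
    then have "N (x' + u *\<^sub>R y') + N (x' - u *\<^sub>R y') \<le> 2 + 2 * \<gamma> * u powr q"
      by (simp add: field_simps)
    moreover have "u powr q = u powr (q - 1) * u"
      using u powr_add[of u "q - 1" 1] by simp
    moreover have "2 * \<gamma> * u powr (q - 1) * u \<le> \<epsilon> * u"
      using small u by (intro mult_right_mono) auto
    ultimately have "N (x' + u *\<^sub>R y') + N (x' - u *\<^sub>R y') \<le> 2 + \<epsilon> * u"
      by (simp add: mult.assoc)
    then have "N x * (N (x' + u *\<^sub>R y') + N (x' - u *\<^sub>R y')) \<le> N x * (2 + \<epsilon> * u)"
      using Nx by (intro mult_left_mono) auto
    moreover have "N (N x *\<^sub>R (x' + u *\<^sub>R y')) = N x * N (x' + u *\<^sub>R y')"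
      "N (N x *\<^sub>R (x' - u *\<^sub>R y')) = N x * N (x' - u *\<^sub>R y')"
      using x' y' Nx norm_on_subspace[OF N]
      by (auto simp: norm_on_scale[OF N] subspace_add subspace_diff subspace_scale)
    moreover have "N x *\<^sub>R (x' + u *\<^sub>R y') = x + y" "N x *\<^sub>R (x' - u *\<^sub>R y') = x - y"
      using Nx Ny by (auto simp: x'_def y'_def u_def scaleR_add_right scaleR_diff_right)
    moreover have "N x * (2 + \<epsilon> * u) = 2 * N x + \<epsilon> * N y"
      using Nx by (simp add: u_def field_simps)
    ultimately show ?thesis
      by (simp only: distrib_left)
  qed
  ultimately show "\<exists>\<mu>>0. \<forall>x\<in>X. \<forall>y\<in>X. \<alpha> \<le> N x \<longrightarrow> N y \<le> \<mu> \<longrightarrow>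
        N (x + y) + N (x - y) \<le> 2 * N x + \<epsilon> * N y"
    by blast
qed

text \<open>The functional bounds \<open>N (x + y)\<close> from below by about \<open>N x + F y\<close>; smoothness then
  leaves at most about \<open>N x - F y\<close> for \<open>N (x - y)\<close>.\<close>

lemma near_norming_step:
  assumes N: "norm_on X N" and F: "bounded_functional X N F" "functional_norm X N F \<le> 1"
    and x: "x \<in> X" and y: "y \<in> X" and norming: "(1 - \<delta>) * N x \<le> F x"
    and smooth: "N (x + y) + N (x - y) \<le> 2 * N x + \<epsilon> * N y"
  shows "N (x - y) + F y \<le> (1 + \<delta>) * N x + \<epsilon> * N y"
proof -
  have "x + y \<in> X"
    using x y norm_on_subspace[OF N] by (simp add: subspace_add)
  then have "F (x + y) \<le> N (x + y)"
    using bounded_functional_abs_le[OF N F] by fastforce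
  moreover have "F (x + y) = F x + F y"
    by (rule bounded_functional_add[OF F(1) x y])
  ultimately show ?thesis
    using norming smooth by (simp add: algebra_simps)
qed

section \<open>Best approximation errors\<close>

lemma best_error_lower:
  assumes N: "norm_on X N" and f: "f \<in> X" and "\<Phi> \<subseteq> X" and "G \<in> \<Phi>"
  shows "best_error N f \<Phi> \<le> N (f - G)"
  unfolding best_error_def
proof (rule cINF_lower)
  show "bdd_below ((\<lambda>G. N (f - G)) ` \<Phi>)"
    using assms norm_on_nonneg[OF N] norm_on_subspace[OF N]
    by (intro bdd_belowI2[of _ 0]) (auto simp: subspace_diff)
qed (use assms in auto)

lemma best_error_greatest:
  assumes "\<Phi> \<noteq> {}" and "\<And>G. G \<in> \<Phi> \<Longrightarrow> m \<le> N (f - G)"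
  shows "m \<le> best_error N f \<Phi>"
  unfolding best_error_def using assms by (intro cINF_greatest) auto

section \<open>Convergence\<close>

text \<open>The order of the choices below matters: the slopes in the smoothness estimates and the step
  lengths are fixed before \<open>n\<close>, so that afterwards \<open>\<delta> n + \<eta> n\<close> can be made small against
  them.\<close>

lemma AWCGA_converges_if_uniformly_smooth:
  assumes N: "norm_on X N" and smooth: "uniformly_smooth X N"
    and D: "dictionary X N D" and f: "f \<in> X"
    and t: "t0 > 0" "\<forall>\<^sub>F n in sequentially. t0 \<le> t n"
    and \<delta>: "perturbation_sequence \<delta>"
    and \<eta>: "error_sequence \<eta>" "bounded (\<eta> ` {1..})"
    and small: "\<And>c. c > 0 \<Longrightarrow> \<exists>\<^sub>F n in sequentially. \<delta> n + \<eta> n < c"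
  shows "AWCGA_converges X N D t \<delta> \<eta> f"
  unfolding AWCGA_converges_def
proof (intro allI impI)
  fix F \<phi> G r assume R: "AWCGA_realization X N D t \<delta> \<eta> f F \<phi> G r"
  define \<Phi> where "\<Phi> n = span (\<phi> ` {1..n})" for n
  define E where "E n = best_error N f (\<Phi> n)" for n
  have sub: "subspace X"
    by (rule norm_on_subspace[OF N])
  have Rn: "\<phi> n \<in> D" "G n \<in> \<Phi> n" "N (f - G n) \<le> (1 + \<eta> n) * E n" "r n = f - G n"
    if "n \<ge> 1" for n
    using R that unfolding AWCGA_realization_def E_def \<Phi>_def by blast+
  have RF: "bounded_functional X N (F n)" "functional_norm X N (F n) \<le> 1"
    "(1 - \<delta> n) * N (r n) \<le> F n (r n)"
    "t (Suc n) * (SUP g\<in>D. F n g) \<le> F n (\<phi> (Suc n))" for n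
    using R[unfolded AWCGA_realization_def, THEN conjunct2, rule_format, of "Suc n"] by simp_all
  have DX: "D \<subseteq> X" "\<And>g. g \<in> D \<Longrightarrow> N g = 1"
    using D by (auto simp: dictionary_def)
  have \<Phi>X: "\<Phi> n \<subseteq> X" for n
    unfolding \<Phi>_def using Rn(1) DX(1) by (intro span_minimal sub) auto
  have \<Phi>_mono: "\<Phi> m \<subseteq> \<Phi> n" if "m \<le> n" for m n
    unfolding \<Phi>_def using that by (intro span_mono image_mono) auto
  have E_le: "E n \<le> N (f - g)" if "g \<in> \<Phi> n" for n g
    unfolding E_def using that by (rule best_error_lower[OF N f \<Phi>X])
  have \<Phi>_0: "0 \<in> \<Phi> n" for n
    by (simp add: \<Phi>_def span_zero)
  then have E_nonneg: "0 \<le> E n" for n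
    unfolding E_def using \<Phi>X[of n] f sub
    by (intro best_error_greatest) (auto intro!: norm_on_nonneg[OF N] subspace_diff)
  have E_f: "E n \<le> N f" for n
    using E_le[OF \<Phi>_0] by simp
  have E_dec: "decseq E"
  proof (rule decseq_SucI)
    show "E (Suc n) \<le> E n" for n
      unfolding E_def[of n] using \<Phi>_0[of n] \<Phi>_mono[of n "Suc n"] E_le[of _ "Suc n"]
      by (intro best_error_greatest) auto
  qed
  obtain \<alpha> where \<alpha>: "E \<longlonglongrightarrow> \<alpha>" "\<And>n. \<alpha> \<le> E n"
    using decseq_convergent[OF E_dec, of 0] E_nonneg by blast
  have GX: "G n \<in> X" "r n \<in> X" if "n \<ge> 1" for n
  proof -
    show "G n \<in> X"
      using Rn(2)[OF that] \<Phi>X by blast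
    then show "r n \<in> X"
      using Rn(4)[OF that] f sub by (simp add: subspace_diff)
  qed
  obtain C where C: "\<And>n. n \<ge> 1 \<Longrightarrow> \<eta> n \<le> C"
  proof -
    obtain C where "\<forall>x\<in>\<eta> ` {1..}. norm x \<le> C"
      using \<eta>(2) unfolding bounded_iff by blast
    then have "\<eta> n \<le> C" if "n \<ge> 1" for n
      using that abs_ge_self[of "\<eta> n"] by (auto intro: order_trans)
    then show ?thesis
      by (rule that)
  qed
  have r_le: "N (r n) \<le> (1 + C) * E n" if "n \<ge> 1" for n
    using Rn(3,4)[OF that] mult_right_mono[of "1 + \<eta> n" "1 + C", OF _ E_nonneg[of n]] C[OF that]
    by simp
  have "\<alpha> = 0"
  proof (rule ccontr)
    assume "\<alpha> \<noteq> 0"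
    then have \<alpha>_pos: "\<alpha> > 0"
      using LIMSEQ_le_const[OF \<alpha>(1), of 0] E_nonneg by fastforce
    then have Nf: "N f > 0"
      using \<alpha>(2)[of 0] E_f[of 0] by linarith
    have \<eta>0: "\<eta> n \<ge> 0" if "n \<ge> 1" for n
      using \<eta>(1) that by (simp add: error_sequence_def)
    have \<delta>0: "0 \<le> \<delta> n" "\<delta> n \<le> 1" for n
      using \<delta> by (auto simp: perturbation_sequence_def)
    have C0: "C \<ge> 0"
      using C[of 1] \<eta>0[of 1] by simp
    define M where "M = (2 + C) * N f"
    have M: "M > 0" "N f \<le> M"
      using Nf C0 by (auto simp: M_def algebra_simps add_pos_nonneg add_nonneg_pos)
    have r_bounds: "\<alpha> \<le> E n" "E n \<le> N (r n)" "N (r n) \<le> M" "N (G n) \<le> M" if n: "n \<ge> 1" for n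
    proof -
      show "\<alpha> \<le> E n" by (rule \<alpha>)
      show "E n \<le> N (r n)"
        using E_le[OF Rn(2)[OF n]] Rn(4)[OF n] by simp
      have "N (r n) \<le> (1 + C) * N f"
        using r_le[OF n] mult_left_mono[OF E_f[of n], of "1 + C"] C0 by linarith
      moreover have "N (G n) \<le> N f + N (r n)"
        using norm_on_triangle_diff[OF N f GX(2)[OF n]] Rn(4)[OF n] by simp
      ultimately show "N (r n) \<le> M" "N (G n) \<le> M"
        using Nf by (auto simp: M_def algebra_simps)
    qed
    obtain h where h: "h \<in> span D" "N (f - h) < \<alpha> / 4"
      using dictionary_approximates[OF N D f, of "\<alpha> / 4"] \<alpha>_pos by auto
    have hX: "h \<in> X"
      using h(1) span_minimal[OF DX(1) sub] by blast
    obtain A where A: "A \<ge> 0" "\<And>n. \<bar>F n h\<bar> \<le> A * (SUP g\<in>D. F n g)"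
      using span_dictionary_functional_bound[OF N D h(1)] RF(1,2) by blast

    \<comment> \<open>When \<open>\<delta> n + \<eta> n\<close> is small the functional is not very negative at \<open>G n\<close>, so it is large
      at \<open>f\<close>, hence at \<open>h\<close>, hence at some dictionary element.\<close>
    define \<epsilon>\<^sub>1 where "\<epsilon>\<^sub>1 = \<alpha> / (8 * M)"
    have \<epsilon>1: "\<epsilon>\<^sub>1 > 0"
      using \<alpha>_pos M by (simp add: \<epsilon>\<^sub>1_def)
    obtain \<mu>\<^sub>1 where \<mu>1: "\<mu>\<^sub>1 > 0"
      "\<And>x y. \<lbrakk>x \<in> X; y \<in> X; \<alpha> \<le> N x; N y \<le> \<mu>\<^sub>1\<rbrakk> \<Longrightarrow> N (x + y) + N (x - y) \<le> 2 * N x + \<epsilon>\<^sub>1 * N y"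
      using smooth[unfolded uniformly_smooth_def, rule_format, OF \<alpha>_pos \<epsilon>1] by blast
    define l\<^sub>1 where "l\<^sub>1 = \<mu>\<^sub>1 / M"
    have l1: "l\<^sub>1 > 0" "l\<^sub>1 * M = \<mu>\<^sub>1"
      using \<mu>1(1) M by (auto simp: l\<^sub>1_def)
    have functional_large: "\<alpha> / 4 \<le> A * (SUP g\<in>D. F n g)"
      if n: "n \<ge> 1" and e: "\<delta> n + \<eta> n \<le> 1/8" "M * (\<delta> n + \<eta> n) \<le> l\<^sub>1 * \<alpha> / 8" for n
    proof -
      \<comment> \<open>The step only rescales \<open>G n\<close>, so it stays in \<open>\<Phi> n\<close> and cannot beat \<open>E n\<close>.\<close>
      define y where "y = (- l\<^sub>1) *\<^sub>R G n"
      have y: "y \<in> X" "N y = l\<^sub>1 * N (G n)"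
        using GX(1)[OF n] sub l1 norm_on_scale[OF N GX(1)[OF n], of "- l\<^sub>1"]
        by (auto simp: y_def subspace_scale subspace_neg)
      then have "N y \<le> \<mu>\<^sub>1"
        using mult_left_mono[OF r_bounds(4)[OF n], of l\<^sub>1] l1 by simp
      then have "N (r n - y) + F n y \<le> (1 + \<delta> n) * N (r n) + \<epsilon>\<^sub>1 * N y"
        using n r_bounds[OF n] GX[OF n] y
        by (intro near_norming_step[OF N RF(1,2) _ _ RF(3)] \<mu>1(2)) auto
      moreover have "E n \<le> N (r n - y)"
      proof -
        have "r n - y = f - (1 - l\<^sub>1) *\<^sub>R G n"
          using Rn(4)[OF n] by (simp add: y_def algebra_simps)
        moreover have "(1 - l\<^sub>1) *\<^sub>R G n \<in> \<Phi> n"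
          using Rn(2)[OF n] unfolding \<Phi>_def by (rule span_scale)
        ultimately show ?thesis
          using E_le by simp
      qed
      moreover have "N (r n) \<le> (1 + \<eta> n) * E n"
        using Rn[OF n] by simp
      moreover have "\<eta> n * E n \<le> \<eta> n * M" "\<delta> n * N (r n) \<le> \<delta> n * M"
        using r_bounds[OF n] \<eta>0[OF n] \<delta>0 by (intro mult_left_mono; simp)+
      moreover have "\<epsilon>\<^sub>1 * N y \<le> l\<^sub>1 * \<alpha> / 8"
      proof -
        have "\<epsilon>\<^sub>1 * N y \<le> \<epsilon>\<^sub>1 * (l\<^sub>1 * M)"
          using y(2) \<epsilon>1 l1 r_bounds(4)[OF n] by (intro mult_left_mono) auto
        also have "\<dots> = l\<^sub>1 * \<alpha> / 8"
          using M by (simp add: \<epsilon>\<^sub>1_def)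
        finally show ?thesis .
      qed
      ultimately have "F n y \<le> M * (\<delta> n + \<eta> n) + l\<^sub>1 * \<alpha> / 8"
        by (simp add: algebra_simps)
      then have "F n y \<le> l\<^sub>1 * (\<alpha> / 4)"
        using e(2) by simp
      moreover have "F n y = (- l\<^sub>1) * F n (G n)"
        unfolding y_def by (rule bounded_functional_scale[OF RF(1) GX(1)[OF n]])
      ultimately have "l\<^sub>1 * (- F n (G n)) \<le> l\<^sub>1 * (\<alpha> / 4)"
        by simp
      then have "- F n (G n) \<le> \<alpha> / 4"
        using l1(1) by (simp only: mult_le_cancel_left_pos)
      moreover have "(1 - 1/8) * \<alpha> \<le> (1 - \<delta> n) * N (r n)"
        using e(1) \<eta>0[OF n] \<delta>0[of n] r_bounds[OF n] \<alpha>_pos by (intro mult_mono) auto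
      moreover have "F n (r n + G n) = F n (r n) + F n (G n)"
        by (rule bounded_functional_add[OF RF(1) GX(2)[OF n] GX(1)[OF n]])
      moreover have "r n + G n = f"
        using Rn(4)[OF n] by simp
      ultimately have "F n f \<ge> \<alpha> / 2"
        using RF(3)[of n] \<alpha>_pos by simp
      moreover have "\<bar>F n (f - h)\<bar> \<le> N (f - h)"
        using f hX sub by (intro bounded_functional_abs_le[OF N RF(1,2)]) (simp add: subspace_diff)
      moreover have "F n ((f - h) + h) = F n (f - h) + F n h"
        by (rule bounded_functional_add[OF RF(1) subspace_diff[OF sub f hX] hX])
      ultimately show ?thesis
        using h(2) A(2)[of n] by simp
    qed
    have freq: "\<exists>n\<ge>m. \<delta> n + \<eta> n < c" if "c > 0" for m c
      using small[OF that] unfolding frequently_sequentially by blast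
    obtain n\<^sub>t where n\<^sub>t: "\<And>n. n \<ge> n\<^sub>t \<Longrightarrow> t0 \<le> t n"
      using t(2) unfolding eventually_sequentially by blast
    \<comment> \<open>\<open>A = 0\<close> would make \<open>h\<close> invisible to every functional, contrary to the last estimate.\<close>
    have A_pos: "A > 0"
    proof -
      obtain n where n: "n \<ge> 1" "\<delta> n + \<eta> n < min (1/8) (l\<^sub>1 * \<alpha> / 8 / M)"
        using freq[of "min (1/8) (l\<^sub>1 * \<alpha> / 8 / M)" 1] l1 \<alpha>_pos M by auto
      then have "\<delta> n + \<eta> n \<le> l\<^sub>1 * \<alpha> / 8 / M"
        by simp
      then have "M * (\<delta> n + \<eta> n) \<le> l\<^sub>1 * \<alpha> / 8"
        using M by (simp add: field_simps)
      then have "\<alpha> / 4 \<le> A * (SUP g\<in>D. F n g)"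
        using functional_large[of n] n by simp
      then show ?thesis
        using A(1) \<alpha>_pos by (cases "A = 0") auto
    qed
    define \<beta> where "\<beta> = t0 * (\<alpha> / (4 * A))"
    have \<beta>: "\<beta> > 0"
      using \<alpha>_pos A_pos t(1) by (simp add: \<beta>_def)

    \<comment> \<open>For suitable \<open>n\<close> the step along \<open>\<phi> (Suc n)\<close> of the fixed length \<open>\<mu>\<^sub>2\<close> lowers the error below \<open>\<alpha>\<close>.\<close>
    obtain \<mu>\<^sub>2 where \<mu>2: "\<mu>\<^sub>2 > 0"
      "\<And>x y. \<lbrakk>x \<in> X; y \<in> X; \<alpha> \<le> N x; N y \<le> \<mu>\<^sub>2\<rbrakk> \<Longrightarrow> N (x + y) + N (x - y) \<le> 2 * N x + (\<beta> / 4) * N y"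
      using smooth[unfolded uniformly_smooth_def, rule_format, OF \<alpha>_pos, of "\<beta> / 4"] \<beta> by auto
    have "\<forall>\<^sub>F n in sequentially. E n < \<alpha> + \<mu>\<^sub>2 * \<beta> / 4"
      using \<alpha>(1) \<mu>2(1) \<beta> by (intro order_tendstoD(2)[of E \<alpha>]) auto
    then obtain n\<^sub>E where n\<^sub>E: "\<And>n. n \<ge> n\<^sub>E \<Longrightarrow> E n < \<alpha> + \<mu>\<^sub>2 * \<beta> / 4"
      unfolding eventually_sequentially by blast
    define c where "c = min (1/8) (min (l\<^sub>1 * \<alpha> / 8 / M) (\<mu>\<^sub>2 * \<beta> / 8 / M))"
    have "c > 0"
      using l1 \<alpha>_pos M \<mu>2(1) \<beta> by (simp add: c_def)
    then obtain n where n: "n \<ge> max 1 (max n\<^sub>t n\<^sub>E)" "\<delta> n + \<eta> n < c"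
      using freq by blast
    then have "\<delta> n + \<eta> n \<le> l\<^sub>1 * \<alpha> / 8 / M" "\<delta> n + \<eta> n \<le> \<mu>\<^sub>2 * \<beta> / 8 / M"
      by (auto simp: c_def)
    then have e: "\<delta> n + \<eta> n \<le> 1/8" "M * (\<delta> n + \<eta> n) \<le> l\<^sub>1 * \<alpha> / 8" "M * (\<delta> n + \<eta> n) \<le> \<mu>\<^sub>2 * \<beta> / 8"
      using n(2) M by (auto simp: c_def field_simps)
    have n1: "n \<ge> 1" and nt: "t0 \<le> t (Suc n)" and nE: "E n < \<alpha> + \<mu>\<^sub>2 * \<beta> / 4"
      using n(1) n\<^sub>t[of "Suc n"] n\<^sub>E[of n] by auto
    define S where "S = (SUP g\<in>D. F n g)"
    have S: "\<alpha> / (4 * A) \<le> S"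
      using functional_large[OF n1 e(1,2)] A_pos by (simp add: S_def field_simps)
    moreover have "\<alpha> / (4 * A) > 0"
      using \<alpha>_pos A_pos by simp
    ultimately have "\<beta> \<le> t (Suc n) * S"
      unfolding \<beta>_def using nt t(1) by (intro mult_mono) auto
    then have F\<phi>: "\<beta> \<le> F n (\<phi> (Suc n))"
      using RF(4)[of n] by (simp add: S_def)
    define y where "y = \<mu>\<^sub>2 *\<^sub>R \<phi> (Suc n)"
    have \<phi>D: "\<phi> (Suc n) \<in> X" "N (\<phi> (Suc n)) = 1"
      using Rn(1)[of "Suc n"] DX by auto
    have y: "y \<in> X" "N y = \<mu>\<^sub>2"
      using \<phi>D sub \<mu>2(1) norm_on_scale[OF N \<phi>D(1)] by (auto simp: y_def subspace_scale)
    have "N (r n - y) + F n y \<le> (1 + \<delta> n) * N (r n) + (\<beta> / 4) * N y"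
      using n1 r_bounds[OF n1] GX[OF n1] y
      by (intro near_norming_step[OF N RF(1,2) _ _ RF(3)] \<mu>2(2)) auto
    moreover have "F n y = \<mu>\<^sub>2 * F n (\<phi> (Suc n))"
      unfolding y_def by (rule bounded_functional_scale[OF RF(1) \<phi>D(1)])
    moreover have "\<mu>\<^sub>2 * \<beta> \<le> \<mu>\<^sub>2 * F n (\<phi> (Suc n))"
      using F\<phi> \<mu>2(1) by simp
    moreover have "E (Suc n) \<le> N (r n - y)"
    proof -
      have "\<phi> (Suc n) \<in> \<Phi> (Suc n)"
        by (auto simp: \<Phi>_def intro!: span_base)
      moreover have "G n \<in> \<Phi> (Suc n)"
        using Rn(2)[OF n1] \<Phi>_mono[of n "Suc n"] by auto
      ultimately have "G n + y \<in> \<Phi> (Suc n)"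
        unfolding y_def \<Phi>_def by (simp add: span_add span_scale)
      then show ?thesis
        using E_le[of "G n + y" "Suc n"] Rn(4)[OF n1] by (simp add: diff_diff_eq)
    qed
    moreover have "\<alpha> \<le> E (Suc n)"
      by (rule \<alpha>)
    moreover have "N (r n) \<le> (1 + \<eta> n) * E n"
      using Rn[OF n1] by simp
    moreover have "\<eta> n * E n \<le> \<eta> n * M" "\<delta> n * N (r n) \<le> \<delta> n * M"
      using r_bounds[OF n1] \<eta>0[OF n1] \<delta>0 by (intro mult_left_mono; simp)+
    ultimately have "\<alpha> + \<mu>\<^sub>2 * \<beta> \<le> E n + M * (\<delta> n + \<eta> n) + \<mu>\<^sub>2 * \<beta> / 4"
      using y(2) by (simp add: algebra_simps)
    moreover have "\<mu>\<^sub>2 * \<beta> > 0"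
      using \<mu>2(1) \<beta> by simp
    ultimately show False
      using nE e(3) by linarith
  qed
  then have lim: "(\<lambda>n. (1 + C) * E n) \<longlonglongrightarrow> 0"
    using tendsto_mult_right_zero[of E sequentially "1 + C"] \<alpha>(1) by simp
  have upper: "\<forall>\<^sub>F n in sequentially. N (r n) \<le> (1 + C) * E n"
    using r_le by (auto simp: eventually_sequentially)
  have lower: "\<forall>\<^sub>F n in sequentially. 0 \<le> N (r n)"
    using norm_on_nonneg[OF N GX(2)] by (auto simp: eventually_sequentially)
  show "(\<lambda>n. N (r n)) \<longlonglongrightarrow> 0"
    by (rule tendsto_sandwich[OF lower upper tendsto_const lim])
qed

section \<open>A finite-dimensional Euclidean space\<close>

text \<open>The ambient space has no topology, so the coordinates are those of a Hamel basis; being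
  defined on the whole space, they are linear without side conditions.\<close>

lemma biorthogonal_sequence_exists:
  assumes "infinite_dimensional TYPE('a::real_vector)"
  shows "\<exists>(b :: nat \<Rightarrow> 'a) c. (\<forall>i. linear (c i)) \<and> (\<forall>i j. c i (b j) = (if i = j then 1 else 0 :: real))"
proof -
  obtain B :: "'a set" where B: "independent B" "span B = UNIV"
    by (metis basis_exists[of UNIV] top.extremum_uniqueI)
  then have "infinite B"
    using assms by (auto simp: infinite_dimensional_def)
  then obtain b :: "nat \<Rightarrow> 'a" where b: "inj b" "range b \<subseteq> B"
    using infinite_countable_subset by blast
  define c where "c i x = representation B x (b i)" for i x
  have "linear (c i)" for i
    unfolding c_def using B
    by (intro linearI) (simp_all add: representation_add representation_scale)
  moreover have "c i (b j) = (if i = j then 1 else 0)" for i j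
  proof -
    have "b j \<in> B"
      using b(2) by blast
    then show ?thesis
      using b(1) B(1) by (simp add: c_def representation_basis inj_eq)
  qed
  ultimately show ?thesis
    by blast
qed

locale biorthogonal =
  fixes b :: "nat \<Rightarrow> 'a::real_vector" and c :: "nat \<Rightarrow> 'a \<Rightarrow> real"
  assumes linear_coord: "linear (c i)"
    and coord_basis: "c i (b j) = (if i = j then 1 else 0)"
begin

definition V :: "nat \<Rightarrow> 'a set" where
  "V n = span (b ` {..<n})"

definition nrm :: "nat \<Rightarrow> 'a \<Rightarrow> real" where
  "nrm n x = L2_set (\<lambda>i. c i x) {..<n}"

definition axes :: "nat \<Rightarrow> 'a set" where
  "axes n = b ` {..<n} \<union> (\<lambda>i. - b i) ` {..<n}"

lemma coord_simps [simp]: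
  "c i (x + y) = c i x + c i y" "c i (x - y) = c i x - c i y" "c i (a *\<^sub>R x) = a * c i x"
  "c i 0 = 0" "c i (- x) = - c i x" "c i (sum g A) = (\<Sum>j\<in>A. c i (g j))"
  using linear_coord[of i]
  by (simp_all add: linear_add linear_diff linear_scale linear_0 linear_neg linear_sum)

lemma subspace_V: "subspace (V n)"
  by (simp add: V_def subspace_span)

lemma basis_in_V: "i < n \<Longrightarrow> b i \<in> V n"
  by (simp add: V_def span_base)

lemma coord_eq_0: "x \<in> V n \<Longrightarrow> n \<le> i \<Longrightarrow> c i x = 0"
  unfolding V_def by (induction rule: span_induct_alt) (auto simp: coord_basis)

lemma V_expand:
  assumes "x \<in> V n"
  shows "x = (\<Sum>i<n. c i x *\<^sub>R b i)"
  using assms unfolding V_def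
proof (induction rule: span_induct_alt)
  case (step a y z)
  then obtain j where "j < n" "y = b j"
    by auto
  then have "(\<Sum>i<n. c i y *\<^sub>R b i) = (\<Sum>i<n. if i = j then b j else 0)"
    by (intro sum.cong) (auto simp: coord_basis)
  also have "\<dots> = y"
    using \<open>j < n\<close> \<open>y = b j\<close> by simp
  finally have y: "(\<Sum>i<n. c i y *\<^sub>R b i) = y" .
  have "(\<Sum>i<n. c i (a *\<^sub>R y + z) *\<^sub>R b i)
      = a *\<^sub>R (\<Sum>i<n. c i y *\<^sub>R b i) + (\<Sum>i<n. c i z *\<^sub>R b i)"
    by (simp add: scaleR_add_left sum.distrib scaleR_sum_right)
  then show ?case
    using y step by simp
qed simp

lemma coord_le_nrm: "i < n \<Longrightarrow> \<bar>c i x\<bar> \<le> nrm n x"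
  using member_le_L2_set[of "{..<n}" i "\<lambda>i. \<bar>c i x\<bar>"] by (simp add: nrm_def L2_set_def)

lemma norm_on_V: "norm_on (V n) (nrm n)"
  unfolding norm_on_def
proof (intro conjI ballI allI)
  fix x assume x: "x \<in> V n"
  show "nrm n x = 0 \<longleftrightarrow> x = 0"
    using V_expand[OF x] by (auto simp: nrm_def L2_set_eq_0_iff)
next
  show "nrm n (a *\<^sub>R x) = \<bar>a\<bar> * nrm n x" for a x
    by (simp add: nrm_def L2_set_def power_mult_distrib real_sqrt_mult flip: sum_distrib_left)
next
  show "nrm n (x + y) \<le> nrm n x + nrm n y" for x y
    unfolding nrm_def coord_simps by (rule L2_set_triangle_ineq)
qed (simp_all add: subspace_V nrm_def)

text \<open>A Cauchy sequence converges coordinatewise, and the norm is at most the sum of the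
  absolute coordinates.\<close>

lemma banach_space_V: "banach_space (V n) (nrm n)"
proof -
  interpret Metric_space "V n" "norm_dist (V n) (nrm n)"
    by (rule Metric_space_norm_dist[OF norm_on_V])
  have "\<exists>x. limitin mtopology \<sigma> x sequentially" if "MCauchy \<sigma>" for \<sigma>
  proof -
    have \<sigma>: "\<sigma> k \<in> V n" for k
      using that by (auto simp: MCauchy_def)
    have cauchy: "\<exists>M. \<forall>k\<ge>M. \<forall>l\<ge>M. nrm n (\<sigma> k - \<sigma> l) < e" if "e > 0" for e
      using \<open>MCauchy \<sigma>\<close> \<open>e > 0\<close> \<sigma> by (auto simp: MCauchy_def norm_dist_def)
    have "Cauchy (\<lambda>k. c i (\<sigma> k))" if "i < n" for i
      unfolding Cauchy_def dist_real_def
      using cauchy coord_le_nrm[OF that, of "\<sigma> _ - \<sigma> _"]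
      by (metis coord_simps(2) le_less_trans)
    then have "\<forall>i\<in>{..<n}. \<exists>l. (\<lambda>k. c i (\<sigma> k)) \<longlonglongrightarrow> l"
      by (auto simp: Cauchy_convergent_iff convergent_def)
    then obtain l where l: "\<And>i. i < n \<Longrightarrow> (\<lambda>k. c i (\<sigma> k)) \<longlonglongrightarrow> l i"
      by (metis lessThan_iff)
    define x where "x = (\<Sum>i<n. l i *\<^sub>R b i)"
    have x: "x \<in> V n"
      unfolding x_def by (intro subspace_sum subspace_V subspace_scale basis_in_V) auto
    have cx: "c i x = l i" if "i < n" for i
      using that by (simp add: x_def coord_basis if_distrib[of "\<lambda>t. _ * t"] cong: if_cong)
    have "(\<lambda>k. \<Sum>i<n. \<bar>c i (\<sigma> k) - l i\<bar>) \<longlonglongrightarrow> (\<Sum>i<n. \<bar>l i - l i\<bar>)"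
      using l by (intro tendsto_intros) auto
    then have lim: "(\<lambda>k. \<Sum>i<n. \<bar>c i (\<sigma> k) - l i\<bar>) \<longlonglongrightarrow> 0"
      by simp
    have bound: "nrm n (\<sigma> k - x) \<le> (\<Sum>i<n. \<bar>c i (\<sigma> k) - l i\<bar>)" for k
      using L2_set_le_sum_abs[of "\<lambda>i. c i (\<sigma> k - x)" "{..<n}"] cx by (simp add: nrm_def)
    have "\<exists>M. \<forall>k\<ge>M. nrm n (\<sigma> k - x) < e" if "e > 0" for e
      using order_tendstoD(2)[OF lim that] bound
      unfolding eventually_sequentially by (meson le_less_trans)
    then show ?thesis
      unfolding limit_metric_sequentially using x \<sigma> by (auto simp: norm_dist_def)
  qed
  then show ?thesis
    using norm_on_V by (simp add: banach_space_def mcomplete_def)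
qed

lemma dictionary_axes: "dictionary (V n) (nrm n) (axes n)"
proof -
  interpret Metric_space "V n" "norm_dist (V n) (nrm n)"
    by (rule Metric_space_norm_dist[OF norm_on_V])
  have nrm_b: "nrm n (b i) = 1" if "i < n" for i
    using that by (simp add: nrm_def L2_set_def coord_basis if_distrib[of "\<lambda>t. t ^ 2"] cong: if_cong)
  have "axes n \<subseteq> V n"
    using basis_in_V subspace_neg[OF subspace_V] by (auto simp: axes_def)
  moreover have "b ` {..<n} \<subseteq> axes n"
    by (simp add: axes_def)
  then have "V n \<subseteq> span (axes n)"
    unfolding V_def by (rule span_mono)
  ultimately have "span (axes n) = V n"
    using span_minimal[OF _ subspace_V] by blast
  then have "mtopology closure_of span (axes n) = V n"
    using closure_of_topspace[of mtopology] by simp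
  then show ?thesis
    using \<open>axes n \<subseteq> V n\<close> nrm_b norm_on_minus[OF norm_on_V basis_in_V]
    by (auto simp: dictionary_def axes_def)
qed

text \<open>By the parallelogram law the modulus is at most \<open>\<surd>(1 + u\<^sup>2) - 1\<close>, hence at most
  \<open>min u u\<^sup>2\<close>, and \<open>u\<^bsup>q\<^esup>\<close> lies above this minimum for all \<open>q\<close> between 1 and 2.\<close>

lemma class_P_V:
  assumes q: "1 < q" "q \<le> 2" and n: "n > 0"
  shows "class_P q (V n) (nrm n)"
proof -
  have nrm_sq: "nrm n x ^ 2 = (\<Sum>i<n. c i x ^ 2)" for x
    by (simp add: nrm_def L2_set_def sum_nonneg)
  have "modulus_of_smoothness (V n) (nrm n) u \<le> 1 * u powr q" if u: "u \<ge> 0" for u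
    unfolding modulus_of_smoothness_def
  proof (rule cSUP_least)
    have "nrm n (b 0) = 1"
      using dictionary_axes[of n] n by (auto simp: dictionary_def axes_def)
    then show "{(x, y). x \<in> V n \<and> y \<in> V n \<and> nrm n x = 1 \<and> nrm n y = 1} \<noteq> {}"
      using basis_in_V[OF n] by blast
  next
    fix p assume "p \<in> {(x, y). x \<in> V n \<and> y \<in> V n \<and> nrm n x = 1 \<and> nrm n y = 1}"
    then obtain x y where p: "p = (x, y)" and xy: "nrm n x = 1" "nrm n y = 1"
      by blast
    define s d where "s = nrm n (x + u *\<^sub>R y)" and "d = nrm n (x - u *\<^sub>R y)"
    have "s\<^sup>2 + d\<^sup>2 = (\<Sum>i<n. 2 * (c i x)\<^sup>2 + 2 * u\<^sup>2 * (c i y)\<^sup>2)"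
      unfolding s_def d_def nrm_sq sum.distrib[symmetric]
      by (intro sum.cong) (auto simp: power2_eq_square algebra_simps)
    also have "\<dots> = 2 * (nrm n x)\<^sup>2 + 2 * u\<^sup>2 * (nrm n y)\<^sup>2"
      by (simp add: nrm_sq sum.distrib sum_distrib_left)
    finally have "s\<^sup>2 + d\<^sup>2 = 2 + 2 * u\<^sup>2"
      using xy by simp
    then have sum_sq: "((s + d) / 2)\<^sup>2 \<le> 1 + u\<^sup>2"
      using zero_le_power2[of "s - d"] by (simp add: power2_eq_square field_simps)
    have le: "(s + d) / 2 \<le> w" if "0 \<le> w" "1 + u\<^sup>2 \<le> w\<^sup>2" for w
      using power2_le_imp_le[OF order_trans[OF sum_sq that(2)] that(1)] .
    have "(s + d) / 2 - 1 \<le> u powr q"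
    proof (cases "u \<le> 1")
      case True
      have "(s + d) / 2 \<le> 1 + u\<^sup>2"
        by (rule le) (simp_all add: power2_sum)
      moreover have "u\<^sup>2 \<le> u powr q"
        using True u q powr_mono'[of q 2 u] by (cases "u = 0") (auto simp: powr_numeral)
      ultimately show ?thesis
        by linarith
    next
      case False
      have "(s + d) / 2 \<le> 1 + u"
        by (rule le) (use u in \<open>simp_all add: power2_sum\<close>)
      moreover have "u \<le> u powr q"
        using False q powr_mono[of 1 q u] by simp
      ultimately show ?thesis
        by linarith
    qed
    then show "(case p of (x, y) \<Rightarrow> (nrm n (x + u *\<^sub>R y) + nrm n (x - u *\<^sub>R y)) / 2 - 1) \<le> 1 * u powr q"
      by (simp add: p s_def d_def)
  qed
  then show ?thesis
    unfolding class_P_def using banach_space_V by (intro conjI exI[of _ 1]) auto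
qed

section \<open>A stalling realization\<close>

definition tail :: "nat \<Rightarrow> nat \<Rightarrow> 'a" where
  "tail n p = (\<Sum>i\<in>{p..<n}. b i)"

text \<open>The inner product with \<open>tail n s\<close>, normalized by the norm of that vector.\<close>

definition tail_functional :: "nat \<Rightarrow> nat \<Rightarrow> 'a \<Rightarrow> real" where
  "tail_functional n s x = (\<Sum>i\<in>{s..<n}. c i x) / sqrt (real (n - s))"

lemma coord_tail: "c i (tail n p) = (if p \<le> i \<and> i < n then 1 else 0)"
  by (simp add: tail_def coord_basis)

lemma nrm_tail: "nrm n (tail n p) = sqrt (real (n - p))"
proof -
  have "(\<Sum>i<n. (c i (tail n p))\<^sup>2) = (\<Sum>i\<in>{p..<n}. 1)"
    by (intro sum.mono_neutral_cong_right) (auto simp: coord_tail)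
  then show ?thesis
    by (simp add: nrm_def L2_set_def)
qed

lemma tail_in_V: "tail n p \<in> V n"
  unfolding tail_def by (intro subspace_sum subspace_V basis_in_V) auto

lemma tail_diff:
  assumes "p \<le> n"
  shows "tail n 0 - tail n p = (\<Sum>i<p. b i)"
proof -
  have "tail n 0 = (\<Sum>i<p. b i) + tail n p"
    using sum.atLeastLessThan_concat[of 0 p n b] assms by (simp add: tail_def atLeast0LessThan)
  then show ?thesis
    by simp
qed

lemma tail_functional_abs_le:
  assumes "s < n"
  shows "\<bar>tail_functional n s x\<bar> \<le> nrm n x"
proof -
  have "\<bar>\<Sum>i\<in>{s..<n}. c i x\<bar> \<le> (\<Sum>i\<in>{s..<n}. \<bar>c i x\<bar> * \<bar>1\<bar>)"
    by simp
  also have "\<dots> \<le> L2_set (\<lambda>i. c i x) {s..<n} * L2_set (\<lambda>i. 1) {s..<n}"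
    by (rule L2_set_mult_ineq)
  also have "\<dots> \<le> nrm n x * sqrt (real (n - s))"
    unfolding nrm_def L2_set_def
    by (intro mult_mono real_sqrt_le_mono sum_mono2) (auto intro: sum_nonneg)
  finally show ?thesis
    using assms by (simp add: tail_functional_def abs_divide divide_le_eq)
qed

lemma bounded_functional_tail:
  assumes "s < n"
  shows "bounded_functional (V n) (nrm n) (tail_functional n s)"
  unfolding bounded_functional_def
proof (intro conjI)
  show "\<exists>K. \<forall>x\<in>V n. \<bar>tail_functional n s x\<bar> \<le> K * nrm n x"
    using tail_functional_abs_le[OF assms] by (intro exI[of _ 1]) simp
qed (simp_all add: tail_functional_def sum.distrib add_divide_distrib flip: sum_distrib_left)

lemma functional_norm_tail:
  assumes "s < n"
  shows "functional_norm (V n) (nrm n) (tail_functional n s) \<le> 1"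
  unfolding functional_norm_def
proof (rule cSUP_least)
  show "{x \<in> V n. nrm n x \<le> 1} \<noteq> {}"
    using subspace_0[OF subspace_V] by (auto simp: nrm_def L2_set_def intro!: exI[of _ 0])
  show "\<bar>tail_functional n s x\<bar> \<le> 1" if "x \<in> {x \<in> V n. nrm n x \<le> 1}" for x
    using that tail_functional_abs_le[OF assms, of x] by simp
qed

lemma tail_functional_tail:
  assumes "s \<le> p"
  shows "tail_functional n s (tail n p) = real (n - p) / sqrt (real (n - s))"
proof -
  have "(\<Sum>i\<in>{s..<n}. c i (tail n p)) = (\<Sum>i\<in>{p..<n}. 1)"
    using assms by (intro sum.mono_neutral_cong_right) (auto simp: coord_tail)
  then show ?thesis
    by (simp add: tail_functional_def)
qed

lemma tail_functional_basis:
  "tail_functional n s (b i) = (if s \<le> i \<and> i < n then 1 / sqrt (real (n - s)) else 0)"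
  by (simp add: tail_functional_def coord_basis)

lemma tail_functional_greedy:
  assumes "s < n" "0 \<le> \<tau>" "\<tau> \<le> 1"
  shows "\<tau> * (SUP g\<in>axes n. tail_functional n s g) \<le> tail_functional n s (b s)"
proof -
  have val: "tail_functional n s (b s) = 1 / sqrt (real (n - s))"
    using assms by (simp add: tail_functional_basis)
  have neg: "tail_functional n s (- x) = - tail_functional n s x" for x
    by (simp add: tail_functional_def sum_negf)
  have "(SUP g\<in>axes n. tail_functional n s g) \<le> tail_functional n s (b s)"
    using assms by (intro cSUP_least) (auto simp: axes_def neg tail_functional_basis)
  then have "\<tau> * (SUP g\<in>axes n. tail_functional n s g) \<le> \<tau> * tail_functional n s (b s)"
    using assms(2) by (rule mult_left_mono)
  also have "\<dots> \<le> 1 * tail_functional n s (b s)"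
    using assms(3) val by (intro mult_right_mono) auto
  finally show ?thesis
    by simp
qed

text \<open>Elements of \<open>V j\<close> leave the coordinates of \<open>tail n 0\<close> from \<open>j\<close> on untouched.\<close>

lemma best_error_tail:
  "sqrt (real (n - j)) \<le> best_error (nrm n) (tail n 0) (V j)"
proof (rule best_error_greatest)
  show "V j \<noteq> {}"
    using subspace_0[OF subspace_V] by blast
  fix G assume G: "G \<in> V j"
  have "real (n - j) = (\<Sum>i\<in>{j..<n}. (c i (tail n 0 - G))\<^sup>2)"
    by (simp add: coord_tail coord_eq_0[OF G])
  also have "\<dots> \<le> (\<Sum>i<n. (c i (tail n 0 - G))\<^sup>2)"
    by (intro sum_mono2) auto
  finally show "sqrt (real (n - j)) \<le> nrm n (tail n 0 - G)"
    unfolding nrm_def L2_set_def by (rule real_sqrt_le_mono)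
qed

text \<open>The functional at step \<open>k\<close> belongs to \<open>tail n (s k)\<close> and the residual is \<open>tail n (p k)\<close>.
  Before \<open>m\<close> the algorithm is exact and \<open>s k = p k = k\<close>.  From \<open>m\<close> on \<open>s k\<close> is stuck at
  \<open>m - 1\<close>, and \<open>p k\<close> is either \<open>m\<close>, which is optimal but is seen by the functional only
  imprecisely, or \<open>m - 1\<close>, which the functional norms exactly but which is not optimal.  In both
  cases the loss is the ratio of the norms of \<open>tail n (m - 1)\<close> and \<open>tail n m\<close>, which is at most
  \<open>1 + \<kappa>\<close> when \<open>n - m\<close> is large.\<close>

lemma AWCGA_stalls:
  assumes t: "weakness_sequence t" and \<delta>: "perturbation_sequence \<delta>" and \<eta>: "error_sequence \<eta>"
    and \<kappa>: "\<kappa> > 0" and m: "m \<ge> 1" "\<And>k. k \<ge> m \<Longrightarrow> \<kappa> \<le> \<delta> k \<or> \<kappa> \<le> \<eta> k"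
    and n: "n > m" "1 \<le> \<kappa> * real (n - m)"
  shows "\<not> AWCGA_converges (V n) (nrm n) (axes n) t \<delta> \<eta> (tail n 0)"
proof
  assume conv: "AWCGA_converges (V n) (nrm n) (axes n) t \<delta> \<eta> (tail n 0)"
  define s where "s k = min k (m - 1)" for k
  define p where "p k = (if k < m then k else if \<kappa> \<le> \<delta> k then m else m - 1)" for k
  have s_less: "s k < n" for k
    using n(1) by (auto simp: s_def)
  have step: "sqrt (real (n - (m - 1))) \<le> (1 + \<kappa>) * sqrt (real (n - m))"
  proof (rule real_le_lsqrt)
    have d: "real (n - (m - 1)) = real (n - m) + 1"
      using m(1) n(1) by (simp add: of_nat_diff)
    have "0 \<le> \<kappa>\<^sup>2 * real (n - m)" by simp
    then have "real (n - m) + 1 \<le> real (n - m) + 2 * (\<kappa> * real (n - m)) + \<kappa>\<^sup>2 * real (n - m)"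
      using n(2) by linarith
    also have "\<dots> = (1 + \<kappa>)\<^sup>2 * real (n - m)"
      by (simp only: power2_sum distrib_right) simp
    finally have "real (n - m) + 1 \<le> (1 + \<kappa>)\<^sup>2 * real (n - m)" .
    then show "real (n - (m - 1)) \<le> ((1 + \<kappa>) * sqrt (real (n - m)))\<^sup>2"
      by (simp only: d power_mult_distrib real_sqrt_pow2[OF of_nat_0_le_iff])
  qed (use \<kappa> in simp)
  have norming: "(1 - \<delta> k) * nrm n (tail n (p k)) \<le> tail_functional n (s k) (tail n (p k))" for k
  proof -
    have \<delta>k: "0 \<le> \<delta> k" "\<delta> k \<le> 1"
      using \<delta> by (auto simp: perturbation_sequence_def)
    have "s k \<le> p k"
      using m(1) by (auto simp: s_def p_def)
    have ineq: "(1 - \<delta> k) * sqrt (real (n - s k)) \<le> sqrt (real (n - p k))"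
    proof (cases "p k = s k")
      case True
      then show ?thesis
        using \<delta>k by (simp add: mult_left_le_one_le)
    next
      case False
      then have *: "p k = m" "s k = m - 1" "\<kappa> \<le> \<delta> k"
        using m(1) by (auto simp: s_def p_def split: if_splits)
      have "(1 - \<delta> k) * sqrt (real (n - (m - 1))) \<le> (1 - \<kappa>) * ((1 + \<kappa>) * sqrt (real (n - m)))"
        using step *(3) \<delta>k by (intro mult_mono) auto
      \<comment> \<open>\<open>(1 - \<kappa>) (1 + \<kappa>) \<le> 1\<close>\<close>
      also have "\<dots> \<le> sqrt (real (n - m))"
        using \<kappa> by (simp add: algebra_simps)
      finally show ?thesis
        by (simp add: *)
    qed
    have "(1 - \<delta> k) * sqrt (real (n - p k)) * sqrt (real (n - s k))
        = (1 - \<delta> k) * sqrt (real (n - s k)) * sqrt (real (n - p k))"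
      by (simp add: ac_simps)
    also have "\<dots> \<le> sqrt (real (n - p k)) * sqrt (real (n - p k))"
      using ineq by (rule mult_right_mono) simp
    finally show ?thesis
      using s_less[of k] \<open>s k \<le> p k\<close>
      by (simp add: nrm_tail tail_functional_tail le_divide_eq)
  qed
  have spans: "span ((\<lambda>k. b (s (k - 1))) ` {1..k}) = V (min k m)" for k
  proof -
    have "(\<lambda>k. b (s (k - 1))) ` {1..k} = b ` ((\<lambda>k. s (k - 1)) ` {1..k})"
      by (simp add: image_image)
    also have "(\<lambda>k. s (k - 1)) ` {1..k} = {..<min k m}"
    proof (intro set_eqI iffI)
      show "i \<in> {..<min k m}" if "i \<in> (\<lambda>k. s (k - 1)) ` {1..k}" for i
        using that m(1) by (auto simp: s_def)
      show "i \<in> (\<lambda>k. s (k - 1)) ` {1..k}" if "i \<in> {..<min k m}" for i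
        using that by (intro image_eqI[of _ _ "Suc i"]) (auto simp: s_def)
    qed
    finally show ?thesis
      by (simp add: V_def)
  qed
  have near_best: "nrm n (tail n (p k)) \<le> (1 + \<eta> k) * best_error (nrm n) (tail n 0) (V (min k m))"
    if k: "k \<ge> 1" for k
  proof -
    have \<eta>k: "0 \<le> \<eta> k"
      using \<eta> k by (simp add: error_sequence_def)
    have "sqrt (real (n - p k)) \<le> (1 + \<eta> k) * sqrt (real (n - min k m))"
    proof (cases "p k = min k m")
      case True
      then show ?thesis
        using \<eta>k mult_right_mono[of 1 "1 + \<eta> k" "sqrt (real (n - p k))"] by simp
    next
      case False
      then have *: "p k = m - 1" "min k m = m" "k \<ge> m" "\<not> \<kappa> \<le> \<delta> k"
        by (auto simp: p_def split: if_splits)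
      then have "\<kappa> \<le> \<eta> k"
        using m(2) by blast
      then have "(1 + \<kappa>) * sqrt (real (n - m)) \<le> (1 + \<eta> k) * sqrt (real (n - m))"
        by (intro mult_right_mono) auto
      then show ?thesis
        using step by (simp add: *)
    qed
    also have "\<dots> \<le> (1 + \<eta> k) * best_error (nrm n) (tail n 0) (V (min k m))"
      using best_error_tail \<eta>k by (intro mult_left_mono) auto
    finally show ?thesis
      by (simp add: nrm_tail)
  qed
  have "AWCGA_realization (V n) (nrm n) (axes n) t \<delta> \<eta> (tail n 0)
          (\<lambda>k. tail_functional n (s k)) (\<lambda>k. b (s (k - 1))) (\<lambda>k. \<Sum>i<p k. b i) (\<lambda>k. tail n (p k))"
    unfolding AWCGA_realization_def spans
  proof (intro conjI allI impI)
    show "tail n (p 0) = tail n 0"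
      using m(1) by (simp add: p_def)
  next
    fix k :: nat assume k: "k \<ge> 1"
    have diff: "tail n 0 - (\<Sum>i<p k. b i) = tail n (p k)"
    proof -
      have "p k \<le> n"
        using n(1) by (auto simp: p_def)
      then show ?thesis
        using tail_diff[of "p k" n] by (simp add: algebra_simps)
    qed
    then show "tail n (p k) = tail n 0 - (\<Sum>i<p k. b i)"
      by simp
    show "nrm n (tail n 0 - (\<Sum>i<p k. b i)) \<le> (1 + \<eta> k) * best_error (nrm n) (tail n 0) (V (min k m))"
      unfolding diff by (rule near_best[OF k])
    show "b (s (k - 1)) \<in> axes n"
      using s_less by (simp add: axes_def)
    show "t k * (SUP g\<in>axes n. tail_functional n (s (k - 1)) g)
        \<le> tail_functional n (s (k - 1)) (b (s (k - 1)))"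
      using t k s_less by (intro tail_functional_greedy) (auto simp: weakness_sequence_def)
    show "(\<Sum>i<p k. b i) \<in> V (min k m)"
      using k by (intro subspace_sum subspace_V basis_in_V) (auto simp: p_def split: if_splits)
  qed (use norming bounded_functional_tail functional_norm_tail s_less in auto)
  then have "(\<lambda>k. nrm n (tail n (p k))) \<longlonglongrightarrow> 0"
    using conv unfolding AWCGA_converges_def by blast
  moreover have "1 \<le> nrm n (tail n (p k))" for k
    using n(1) by (auto simp: nrm_tail p_def)
  ultimately show False
    using LIMSEQ_le_const[of "\<lambda>k. nrm n (tail n (p k))" 0 1] by simp
qed

end

theorem theorem2:
  fixes q :: real and t \<delta> \<eta> :: "nat \<Rightarrow> real"
  assumes ambient: "infinite_dimensional TYPE('a::real_vector)"
    and q: "1 < q" "q \<le> 2"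
    and t: "weakness_sequence t" "liminf (\<lambda>n. ereal (t n)) > 0"
    and \<delta>: "perturbation_sequence \<delta>"
    and \<eta>: "error_sequence \<eta>" "bounded (\<eta> ` {1..})"
  shows "(\<forall>(X :: 'a set) N D f.
            class_P q X N \<and> dictionary X N D \<and> f \<in> X \<longrightarrow> AWCGA_converges X N D t \<delta> \<eta> f)
         \<longleftrightarrow> liminf (\<lambda>n. ereal (\<delta> n + \<eta> n)) = 0"
proof -
  have nonneg: "\<forall>\<^sub>F n in sequentially. 0 \<le> \<delta> n + \<eta> n"
    using \<delta> \<eta>(1) unfolding eventually_sequentially perturbation_sequence_def error_sequence_def
    by (intro exI[of _ 1]) simp
  show ?thesis
  proof
    assume lim0: "liminf (\<lambda>n. ereal (\<delta> n + \<eta> n)) = 0"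
    obtain t0 where t0: "t0 > 0" "\<forall>\<^sub>F n in sequentially. t0 \<le> t n"
      using t(2) by (auto simp: liminf_pos_iff)
    show "\<forall>(X :: 'a set) N D f.
            class_P q X N \<and> dictionary X N D \<and> f \<in> X \<longrightarrow> AWCGA_converges X N D t \<delta> \<eta> f"
    proof (intro allI impI, elim conjE)
      fix X :: "'a set" and N D f
      assume P: "class_P q X N" and D: "dictionary X N D" and f: "f \<in> X"
      have "norm_on X N"
        using P by (simp add: class_P_def banach_space_def)
      then show "AWCGA_converges X N D t \<delta> \<eta> f"
        using class_P_imp_uniformly_smooth[OF q(1) P] D f t0 \<delta> \<eta>
        by (rule AWCGA_converges_if_uniformly_smooth)
          (use lim0 liminf_eq_0_iff[OF nonneg] in blast)
    qed
  next
    assume conv: "\<forall>(X :: 'a set) N D f.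
            class_P q X N \<and> dictionary X N D \<and> f \<in> X \<longrightarrow> AWCGA_converges X N D t \<delta> \<eta> f"
    show "liminf (\<lambda>n. ereal (\<delta> n + \<eta> n)) = 0"
    proof (rule ccontr)
      assume "liminf (\<lambda>n. ereal (\<delta> n + \<eta> n)) \<noteq> 0"
      then obtain e where e: "e > 0" "\<forall>\<^sub>F n in sequentially. e \<le> \<delta> n + \<eta> n"
        unfolding liminf_eq_0_iff[OF nonneg] frequently_def by (auto simp: not_less)
      then obtain m\<^sub>0 where m0: "\<And>k. k \<ge> m\<^sub>0 \<Longrightarrow> e \<le> \<delta> k + \<eta> k"
        unfolding eventually_sequentially by blast
      define m where "m = max 1 m\<^sub>0"
      have half: "e / 2 \<le> \<delta> k \<or> e / 2 \<le> \<eta> k" if "k \<ge> m" for k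
        using m0[of k] that by (auto simp: m_def)
      obtain d :: nat where d: "1 \<le> (e / 2) * real d"
        using real_arch_simple[of "2 / e"] e(1) by (auto simp: field_simps)
      then have "d > 0"
        by (cases d) auto
      obtain b :: "nat \<Rightarrow> 'a" and c where bc: "\<And>i. linear (c i)"
        "\<And>i j. c i (b j) = (if i = j then 1 else 0 :: real)"
        using biorthogonal_sequence_exists[OF ambient] by blast
      interpret biorthogonal b c
        by (rule biorthogonal.intro) (fact bc)+
      have "\<not> AWCGA_converges (V (m + d)) (nrm (m + d)) (axes (m + d)) t \<delta> \<eta> (tail (m + d) 0)"
        using e(1) d \<open>d > 0\<close> half
        by (intro AWCGA_stalls[OF t(1) \<delta> \<eta>(1), of "e / 2" m]) (auto simp: m_def)
      moreover have "class_P q (V (m + d)) (nrm (m + d))"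
        using q \<open>d > 0\<close> by (intro class_P_V) auto
      ultimately show False
        using conv dictionary_axes tail_in_V by blast
    qed
  qed
qed

end
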